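(* Let $R$ be a reduced ring and $(M,\le)$ a monoid which is totally ordered and in which the ordering is strict. Let $\kappa$ be the largest cardinality of a well-ordered subset of $M$. Then the ring $S=[[R^{M\le}]]$ is weakly Baer if and only if $R$ is weakly Baer and $\mathbf{B}(R)$ is $\kappa$-complete.
   Context: Rings are associative with $1$, not necessarily commutative; a ring is reduced if it has no nonzero nilpotent elements. In a reduced ring left and right annihilators of an element $a$ coincide and are denoted $\operatorname{ann} a$. All idempotents of a reduced ring are central, and $\mathbf{B}(R)$ denotes the boolean algebra of idempotents of $R$ (ordered by $e\le f$ iff $e=ef$). A reduced ring $R$ is weakly Baer (wB) if for every $a\in R$, $\operatorname{ann} a$ is generated by an idempotent, i.e. $\operatorname{ann} a=eR$ for some $e\in\mathbf{B}(R)$. The monoid $M$ is written multiplicatively and is not assumed commutative. The order on $M$ is strict if for all $a,b,c\in M$, $a<b$ implies $ac<bc$ and $ca<cb$. The generalized power series ring $S=[[R^{M\le}]]$ is the set of functions $f\colon M\to R$, $m\mapsto f_m$, whose support $\operatorname{supp} f=\{m\in M\mid f_m\neq 0\}$ is well-ordered, with pointwise addition and convolution multiplication $(fg)_m=\sum_{kl=m}f_kg_l$ (a finite sum because of the condition on supports). A boolean algebra $B$ is $\kappa$-complete, for a cardinal number $\kappa$, if every $E\subseteq B$ with $|E|\le\kappa$ has an infimum in $B$. *)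

theory Defs
  imports "HOL-Algebra.Algebra"
begin

unbundle cardinal_syntax

section \<open>Reduced and weakly Baer rings\<close>

text \<open>The locale \<^locale>\<open>ring\<close> is that of associative, not necessarily commutative, rings with
  one; the zero ring is allowed.\<close>

locale reduced_ring = ring R for R (structure) +
  assumes reduced: "\<lbrakk>a \<in> carrier R; a [^] (n::nat) = \<zero>\<rbrakk> \<Longrightarrow> a = \<zero>"

text \<open>This is the right annihilator of an element; it coincides with the left one when
  \<open>R\<close> is reduced.\<close>

definition ann :: "('a, 'b) ring_scheme \<Rightarrow> 'a \<Rightarrow> 'a set"
  where "ann R a = {x \<in> carrier R. a \<otimes>\<^bsub>R\<^esub> x = \<zero>\<^bsub>R\<^esub>}"

text \<open>This order is a boolean algebra when the idempotents of \<open>R\<close> are central, in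
  particular when \<open>R\<close> is reduced.\<close>

definition idempotents :: "('a, 'b) ring_scheme \<Rightarrow> 'a gorder"
  where "idempotents R =
    \<lparr>carrier = {e \<in> carrier R. e \<otimes>\<^bsub>R\<^esub> e = e}, eq = (=), le = (\<lambda>e f. e = e \<otimes>\<^bsub>R\<^esub> f)\<rparr>"

definition weakly_Baer :: "('a, 'b) ring_scheme \<Rightarrow> bool"
  where "weakly_Baer R \<longleftrightarrow> reduced_ring R \<and>
    (\<forall>a \<in> carrier R. \<exists>e \<in> carrier (idempotents R). ann R a = e <#\<^bsub>R\<^esub> carrier R)"

section \<open>Completeness relative to a cardinal\<close>

text \<open>Cardinals are represented as relations \<open>\<kappa>\<close> with \<^term>\<open>Card_order \<kappa>\<close>.
  The infimum of \<open>E\<close> is taken in \<open>L\<close>; that of the empty set is the top element.\<close>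

definition kappa_complete :: "'k rel \<Rightarrow> ('a, 'b) gorder_scheme \<Rightarrow> bool"
  where "kappa_complete \<kappa> L \<longleftrightarrow>
    (\<forall>E. E \<subseteq> carrier L \<and> |E| \<le>o \<kappa> \<longrightarrow> (\<exists>i. greatest L i (Lower L E)))"

section \<open>Strictly totally ordered monoids\<close>

text \<open>\<open>(a, b) \<in> ord\<close> means \<open>a \<le> b\<close>.\<close>

locale strict_ordered_monoid = monoid M for M (structure) +
  fixes ord :: "'m rel"
  assumes total_order: "linear_order_on (carrier M) ord"
    and strict_right: "\<lbrakk>a \<in> carrier M; b \<in> carrier M; c \<in> carrier M; (a, b) \<in> ord; a \<noteq> b\<rbrakk>
      \<Longrightarrow> (a \<otimes> c, b \<otimes> c) \<in> ord \<and> a \<otimes> c \<noteq> b \<otimes> c"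
    and strict_left: "\<lbrakk>a \<in> carrier M; b \<in> carrier M; c \<in> carrier M; (a, b) \<in> ord; a \<noteq> b\<rbrakk>
      \<Longrightarrow> (c \<otimes> a, c \<otimes> b) \<in> ord \<and> c \<otimes> a \<noteq> c \<otimes> b"

definition well_ordered_subset :: "'m set \<Rightarrow> 'm rel \<Rightarrow> 'm set \<Rightarrow> bool"
  where "well_ordered_subset A ord W \<longleftrightarrow> W \<subseteq> A \<and> well_order_on W (Restr ord W)"

text \<open>The largest cardinality is attained, not merely a supremum. It need not exist:
  the well-ordered subsets of the non-positive integers are the finite ones.\<close>

definition largest_wo_cardinality :: "'m set \<Rightarrow> 'm rel \<Rightarrow> 'k rel \<Rightarrow> bool"
  where "largest_wo_cardinality A ord \<kappa> \<longleftrightarrow> Card_order \<kappa> \<and>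
    (\<exists>W. well_ordered_subset A ord W \<and> |W| =o \<kappa>) \<and>
    (\<forall>W. well_ordered_subset A ord W \<longrightarrow> |W| \<le>o \<kappa>)"

section \<open>Generalized power series\<close>

definition supp :: "('a, 'b) ring_scheme \<Rightarrow> ('m, 'n) monoid_scheme \<Rightarrow> ('m \<Rightarrow> 'a) \<Rightarrow> 'm set"
  where "supp R M f = {m \<in> carrier M. f m \<noteq> \<zero>\<^bsub>R\<^esub>}"

text \<open>The convolution sum runs over pairs in the supports because \<^const>\<open>finsum\<close> over an infinite
  index set is a junk value; for a strict total order the restricted index set is finite.
  Functions on \<open>M\<close> take the value \<^const>\<open>undefined\<close> off the carrier of \<open>M\<close>.\<close>

definition gen_power_series ::
  "('a, 'b) ring_scheme \<Rightarrow> ('m, 'n) monoid_scheme \<Rightarrow> 'm rel \<Rightarrow> ('m \<Rightarrow> 'a) ring"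
  where "gen_power_series R M ord =
    \<lparr>carrier = {f \<in> carrier M \<rightarrow>\<^sub>E carrier R. well_ordered_subset (carrier M) ord (supp R M f)},
     monoid.mult = (\<lambda>f g. \<lambda>m \<in> carrier M.
       finsum R (\<lambda>(k, l). f k \<otimes>\<^bsub>R\<^esub> g l)
         {(k, l) \<in> supp R M f \<times> supp R M g. k \<otimes>\<^bsub>M\<^esub> l = m}),
     one = (\<lambda>m \<in> carrier M. if m = \<one>\<^bsub>M\<^esub> then \<one>\<^bsub>R\<^esub> else \<zero>\<^bsub>R\<^esub>),
     ring.zero = (\<lambda>m \<in> carrier M. \<zero>\<^bsub>R\<^esub>),
     ring.add = (\<lambda>f g. \<lambda>m \<in> carrier M. f m \<oplus>\<^bsub>R\<^esub> g m)\<rparr>"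

end

theory Submission
  imports Defs
begin

text \<open>If \<open>R\<close> is reduced, then \<open>f g = 0\<close> in \<open>S\<close> means \<open>f\<^sub>k g\<^sub>l = 0\<close> for all \<open>k\<close> and \<open>l\<close>. It follows that \<open>S\<close> is reduced and,
  since \<open>e (1 - e) = 0\<close>, that its idempotents are the constants \<open>e \<in> \<^bold>B(R)\<close>. Hence \<open>S\<close> is weakly Baer
  iff for each \<open>f\<close> the common annihilator in \<open>R\<close> of the coefficients of \<open>f\<close> is generated by an idempotent.
  When \<open>R\<close> is weakly Baer with \<open>ann f\<^sub>k = e\<^sub>k R\<close>, such a generator is the infimum of the \<open>e\<^sub>k\<close> with \<open>k\<close> in
  the support of \<open>f\<close>, and each set of at most \<open>\<kappa>\<close> idempotents \<open>e\<close> arises as such a family, from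
  coefficients \<open>1 - e\<close>.\<close>

section \<open>Well-ordered subsets of a strictly ordered monoid\<close>

context strict_ordered_monoid
begin

abbreviation wo :: "'m set \<Rightarrow> bool"
  where "wo \<equiv> well_ordered_subset (carrier M) ord"

abbreviation less (infix \<open>\<prec>\<^sub>o\<close> 50)
  where "x \<prec>\<^sub>o y \<equiv> (x, y) \<in> ord \<and> x \<noteq> y"

section \<open>The linear order and monotonicity of multiplication\<close>

lemma ord_refl: "x \<in> carrier M \<Longrightarrow> (x, x) \<in> ord"
  using total_order by (auto simp: order_on_defs refl_on_def)

lemma ord_antisym: "(x, y) \<in> ord \<Longrightarrow> (y, x) \<in> ord \<Longrightarrow> x = y"
  using total_order by (auto simp: order_on_defs antisym_def)

lemma ord_trans: "(x, y) \<in> ord \<Longrightarrow> (y, z) \<in> ord \<Longrightarrow> (x, z) \<in> ord"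
  using total_order unfolding order_on_defs trans_def by blast

lemma ord_linear: "x \<in> carrier M \<Longrightarrow> y \<in> carrier M \<Longrightarrow> (x, y) \<in> ord \<or> y \<prec>\<^sub>o x"
  using total_order ord_refl[of x] by (cases "x = y") (simp_all add: order_on_defs total_on_def)

lemma mult_mono:
  assumes "a \<in> carrier M" "b \<in> carrier M" "c \<in> carrier M" "d \<in> carrier M"
    and "(a, b) \<in> ord" "(c, d) \<in> ord"
  shows "(a \<otimes> c, b \<otimes> d) \<in> ord"
proof -
  have "(a \<otimes> c, b \<otimes> c) \<in> ord"
    using assms strict_right[of a b c] ord_refl[of "a \<otimes> c"] by (cases "a = b") auto
  moreover have "(b \<otimes> c, b \<otimes> d) \<in> ord"
    using assms strict_left[of c d b] ord_refl[of "b \<otimes> c"] by (cases "c = d") auto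
  ultimately show ?thesis
    by (rule ord_trans)
qed

lemma mult_strict_mono:
  assumes "a \<in> carrier M" "b \<in> carrier M" "c \<in> carrier M" "d \<in> carrier M"
    and "(a, b) \<in> ord" "(c, d) \<in> ord" "a \<noteq> b \<or> c \<noteq> d"
  shows "a \<otimes> c \<prec>\<^sub>o b \<otimes> d"
proof (cases "a = b")
  case True
  then show ?thesis
    using assms strict_left[of c d b] by auto
next
  case False
  then have "a \<otimes> c \<prec>\<^sub>o b \<otimes> c" "(b \<otimes> c, b \<otimes> d) \<in> ord"
    using assms strict_right[of a b c] mult_mono[of b b c d] ord_refl by auto
  then show ?thesis
    using ord_trans ord_antisym by metis
qed

text \<open>In a linear order a minimal element of a set is its least element, so well-foundedness
  of the strict part amounts to the existence of least elements.\<close>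

lemma wo_iff:
  "wo W \<longleftrightarrow> W \<subseteq> carrier M \<and> (\<forall>Z. Z \<subseteq> W \<longrightarrow> Z \<noteq> {} \<longrightarrow> (\<exists>x\<in>Z. \<forall>y\<in>Z. (x, y) \<in> ord))"
    (is "_ \<longleftrightarrow> _ \<and> ?min W")
proof (cases "W \<subseteq> carrier M")
  case True
  have lin: "linear_order_on W (Restr ord W)"
    using total_order True unfolding order_on_defs refl_on_def trans_def antisym_def total_on_def
    by (simp add: Ball_def) blast
  have "wf (Restr ord W - Id) \<longleftrightarrow> ?min W"
  proof
    assume wf: "wf (Restr ord W - Id)"
    show "?min W"
    proof (intro allI impI)
      fix Z assume Z: "Z \<subseteq> W" "Z \<noteq> {}"
      obtain x where x: "x \<in> Z" "\<And>y. (y, x) \<in> Restr ord W - Id \<Longrightarrow> y \<notin> Z"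
        using wfE_min'[OF wf Z(2)] by auto
      have "(x, y) \<in> ord" if y: "y \<in> Z" for y
      proof (rule ccontr)
        assume "(x, y) \<notin> ord"
        moreover have xy: "x \<in> W" "y \<in> W"
          using x(1) y Z(1) by auto
        ultimately have "y \<prec>\<^sub>o x"
          using ord_linear[of x y] True by auto
        then show False
          using x(2)[of y] y xy by auto
      qed
      then show "\<exists>x\<in>Z. \<forall>y\<in>Z. (x, y) \<in> ord"
        using x by blast
    qed
  next
    assume min: "?min W"
    show "wf (Restr ord W - Id)"
    proof (rule wfI_min)
      fix x :: 'm and Q assume "x \<in> Q"
      show "\<exists>z\<in>Q. \<forall>y. (y, z) \<in> Restr ord W - Id \<longrightarrow> y \<notin> Q"
      proof (cases "Q \<inter> W = {}")
        case True
        then show ?thesis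
          using \<open>x \<in> Q\<close> by blast
      next
        case False
        then obtain z where "z \<in> Q \<inter> W" "\<forall>y\<in>Q \<inter> W. (z, y) \<in> ord"
          using min[rule_format, of "Q \<inter> W"] by auto
        then show ?thesis
          using ord_antisym by blast
      qed
    qed
  qed
  then show ?thesis
    using lin True by (simp add: well_ordered_subset_def well_order_on_def)
next
  case False
  then show ?thesis
    by (auto simp: well_ordered_subset_def)
qed

lemma wo_carrier: "wo W \<Longrightarrow> W \<subseteq> carrier M"
  unfolding well_ordered_subset_def by blast

lemma wo_min:
  assumes "wo W" "Z \<subseteq> W" "Z \<noteq> {}"
  shows "\<exists>x\<in>Z. \<forall>y\<in>Z. (x, y) \<in> ord"
  using assms(1)[unfolded wo_iff, THEN conjunct2, rule_format, OF assms(2,3)] .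

lemma wo_subset:
  assumes "wo W" "V \<subseteq> W"
  shows "wo V"
  unfolding wo_iff
proof (intro conjI allI impI)
  show "V \<subseteq> carrier M"
    using assms wo_carrier by blast
  fix Z assume "Z \<subseteq> V" "Z \<noteq> {}"
  then show "\<exists>x\<in>Z. \<forall>y\<in>Z. (x, y) \<in> ord"
    using wo_min[OF assms(1), of Z] assms(2) by simp
qed

lemma wo_singleton: "x \<in> carrier M \<Longrightarrow> wo {x}"
  unfolding wo_iff using ord_refl by (auto simp: subset_singleton_iff)

lemma wo_Un:
  assumes "wo V" "wo W"
  shows "wo (V \<union> W)"
  unfolding wo_iff
proof (intro conjI allI impI)
  show carr: "V \<union> W \<subseteq> carrier M"
    using assms wo_carrier by blast
  fix Z assume Z: "Z \<subseteq> V \<union> W" "Z \<noteq> {}"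
  show "\<exists>x\<in>Z. \<forall>y\<in>Z. (x, y) \<in> ord"
  proof (cases "Z \<inter> V = {} \<or> Z \<inter> W = {}")
    case True
    then have "Z \<subseteq> V \<or> Z \<subseteq> W"
      using Z by blast
    then show ?thesis
      using wo_min[OF assms(1) _ Z(2)] wo_min[OF assms(2) _ Z(2)] by blast
  next
    case False
    \<comment> \<open>The smaller of the two least elements \<open>v\<close> and \<open>w\<close> is
      least in \<open>Z\<close>.\<close>
    obtain v where v: "v \<in> Z \<inter> V" "\<And>y. y \<in> Z \<inter> V \<Longrightarrow> (v, y) \<in> ord"
      using False wo_min[OF assms(1), of "Z \<inter> V"] by auto
    obtain w where w: "w \<in> Z \<inter> W" "\<And>y. y \<in> Z \<inter> W \<Longrightarrow> (w, y) \<in> ord"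
      using False wo_min[OF assms(2), of "Z \<inter> W"] by auto
    from v w have "(v, w) \<in> ord \<or> (w, v) \<in> ord"
      using carr ord_linear[of v w] by blast
    then show ?thesis
    proof
      assume "(v, w) \<in> ord"
      then have "\<forall>y\<in>Z. (v, y) \<in> ord"
        using v(2) w(2) ord_trans[of v w] Z(1) by blast
      then show ?thesis
        using v by blast
    next
      assume "(w, v) \<in> ord"
      then have "\<forall>y\<in>Z. (w, y) \<in> ord"
        using v(2) w(2) ord_trans[of w v] Z(1) by blast
      then show ?thesis
        using w by blast
    qed
  qed
qed

section \<open>Products of well-ordered sets and finiteness of convolution sums\<close>

definition prod_set :: "'m set \<Rightarrow> 'm set \<Rightarrow> 'm set"
  where "prod_set A B = (\<lambda>(k, l). k \<otimes> l) ` (A \<times> B)"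

lemma prod_setI: "a \<in> A \<Longrightarrow> b \<in> B \<Longrightarrow> a \<otimes> b \<in> prod_set A B"
  by (auto simp: prod_set_def)

text \<open>Call \<open>(a, b)\<close> a candidate if \<open>a \<otimes> b \<in> Z\<close> is at most all elements of \<open>Z\<close> with a smaller first
  factor. A candidate with least second factor gives the minimum of \<open>Z\<close>.\<close>

lemma wo_prod_set:
  assumes A: "wo A" and B: "wo B"
  shows "wo (prod_set A B)"
  unfolding wo_iff
proof (intro conjI allI impI)
  note carr = subsetD[OF wo_carrier[OF A]] subsetD[OF wo_carrier[OF B]]
  show "prod_set A B \<subseteq> carrier M"
    using carr by (auto simp: prod_set_def)
  fix Z assume Z: "Z \<subseteq> prod_set A B" "Z \<noteq> {}"
  define cand where "cand a b \<longleftrightarrow> a \<in> A \<and> b \<in> B \<and> a \<otimes> b \<in> Z \<and>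
    (\<forall>a'\<in>A. \<forall>b'\<in>B. a' \<prec>\<^sub>o a \<longrightarrow> a' \<otimes> b' \<in> Z \<longrightarrow> (a \<otimes> b, a' \<otimes> b') \<in> ord)" for a b
  have fst: "\<exists>a\<in>{a\<in>A. \<exists>b\<in>B. P a b}. \<forall>a'\<in>{a\<in>A. \<exists>b\<in>B. P a b}. (a, a') \<in> ord"
    if "a \<in> A" "b \<in> B" "P a b" for P a b
    using that by (intro wo_min[OF A, of "{a\<in>A. \<exists>b\<in>B. P a b}"]) auto
  obtain a b where "a \<in> A" "b \<in> B" "a \<otimes> b \<in> Z"
    using Z by (fastforce simp: prod_set_def)
  \<comment> \<open>With the least possible first factor the condition on smaller first factors is
    vacuous, so a candidate exists.\<close>
  then have "\<exists>b. \<exists>a. cand a b"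
    using fst[of a b "\<lambda>a b. a \<otimes> b \<in> Z"] ord_antisym unfolding cand_def by fast
  then obtain b where b: "\<exists>a. cand a b" "\<And>b'. \<exists>a. cand a b' \<Longrightarrow> (b, b') \<in> ord"
    using wo_min[OF B, of "{b. \<exists>a. cand a b}"] unfolding cand_def by blast
  then obtain a where a: "cand a b"
    by blast
  have "(a \<otimes> b, x) \<in> ord" if x: "x \<in> Z" for x
  proof (rule ccontr)
    assume no: "(a \<otimes> b, x) \<notin> ord"
    have "x \<in> prod_set A B"
      using x Z by blast
    then obtain a0 b0 where ab0: "x = a0 \<otimes> b0" "a0 \<in> A" "b0 \<in> B"
      by (auto simp: prod_set_def)
    \<comment> \<open>Among the pairs whose product in \<open>Z\<close> lies below
      \<open>a \<otimes> b\<close>, take one with least first factor. It is again a candidate, so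
      \<open>b\<close> is at most \<open>b'\<close>; as \<open>a\<close> is at most
      \<open>a'\<close>, monotonicity gives a contradiction.\<close>
    obtain a' b' where a'b': "a' \<in> A" "b' \<in> B" "a' \<otimes> b' \<in> Z" "(a \<otimes> b, a' \<otimes> b') \<notin> ord"
      and min: "\<And>a'' b''. a'' \<in> A \<Longrightarrow> b'' \<in> B \<Longrightarrow> a'' \<otimes> b'' \<in> Z \<Longrightarrow> (a \<otimes> b, a'' \<otimes> b'') \<notin> ord \<Longrightarrow>
        (a', a'') \<in> ord"
      using fst[of a0 b0 "\<lambda>a' b'. a' \<otimes> b' \<in> Z \<and> (a \<otimes> b, a' \<otimes> b') \<notin> ord"] x no ab0 by auto
    have ab: "a \<in> A" "b \<in> B"
      using a by (auto simp: cand_def)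
    have lt: "a' \<otimes> b' \<prec>\<^sub>o a \<otimes> b"
      using ord_linear[of "a \<otimes> b" "a' \<otimes> b'"] a'b' ab carr by auto
    have "cand a' b'"
      unfolding cand_def
    proof (intro conjI ballI impI)
      fix a'' b'' assume *: "a'' \<in> A" "b'' \<in> B" "a'' \<prec>\<^sub>o a'" "a'' \<otimes> b'' \<in> Z"
      then have "(a \<otimes> b, a'' \<otimes> b'') \<in> ord"
        using min ord_antisym by blast
      then show "(a' \<otimes> b', a'' \<otimes> b'') \<in> ord"
        using lt ord_trans by blast
    qed (use a'b' in auto)
    then have "(b, b') \<in> ord"
      using b by blast
    moreover have "(a, a') \<in> ord"
      using a a'b' ord_linear[of a a'] carr unfolding cand_def by blast
    ultimately show False
      using mult_mono[of a a' b b'] a'b' ab carr by blast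
  qed
  then show "\<exists>x\<in>Z. \<forall>y\<in>Z. (x, y) \<in> ord"
    using a by (auto simp: cand_def)
qed

text \<open>Let \<open>F\<close> consist of the elements with finite initial segment, and let
  \<open>x\<close> be the greatest of them. If \<open>x\<close> were not greatest in
  \<open>W\<close>, the least element above \<open>x\<close> would also belong to \<open>F\<close>,
  since its initial segment only adds itself to that of \<open>x\<close>. So \<open>W\<close> is the
  initial segment of \<open>x\<close>.\<close>

lemma finite_of_min_max:
  assumes carr: "W \<subseteq> carrier M"
    and min: "\<And>Z. Z \<subseteq> W \<Longrightarrow> Z \<noteq> {} \<Longrightarrow> \<exists>x\<in>Z. \<forall>y\<in>Z. (x, y) \<in> ord"
    and max: "\<And>Z. Z \<subseteq> W \<Longrightarrow> Z \<noteq> {} \<Longrightarrow> \<exists>x\<in>Z. \<forall>y\<in>Z. (y, x) \<in> ord"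
  shows "finite W"
proof (cases "W = {}")
  case False
  define F where "F = {x \<in> W. finite {y \<in> W. (y, x) \<in> ord}}"
  obtain x0 where x0: "x0 \<in> W" "\<forall>y\<in>W. (x0, y) \<in> ord"
    using min[of W] False by blast
  then have "{y \<in> W. (y, x0) \<in> ord} \<subseteq> {x0}"
    using ord_antisym by blast
  then have "x0 \<in> F"
    using x0 unfolding F_def by (simp add: finite_subset)
  moreover have "F \<subseteq> W"
    by (auto simp: F_def)
  ultimately obtain x where x: "x \<in> F" "\<forall>y\<in>F. (y, x) \<in> ord"
    using max[of F] by blast
  have "W \<subseteq> {y \<in> W. (y, x) \<in> ord}"
  proof (rule ccontr)
    assume "\<not> ?thesis"
    then obtain z where z: "z \<in> W" "(z, x) \<notin> ord"
        "\<forall>y\<in>{y \<in> W. (y, x) \<notin> ord}. (z, y) \<in> ord"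
      using min[of "{y \<in> W. (y, x) \<notin> ord}"] by blast
    then have "{y \<in> W. (y, z) \<in> ord} \<subseteq> insert z {y \<in> W. (y, x) \<in> ord}"
      using ord_antisym by blast
    moreover have "finite (insert z {y \<in> W. (y, x) \<in> ord})"
      using x by (auto simp: F_def)
    ultimately have "z \<in> F"
      using z unfolding F_def by (auto intro: finite_subset)
    then show False
      using x z by blast
  qed
  then show ?thesis
    using x finite_subset unfolding F_def by blast
qed simp

text \<open>The index set of a convolution coefficient. \<open>A\<close> and \<open>B\<close> need
  not be the supports themselves, so that several sums can share one index set.\<close>

definition fibre :: "'m set \<Rightarrow> 'm set \<Rightarrow> 'm \<Rightarrow> ('m \<times> 'm) set"
  where "fibre A B m = {(k, l) \<in> A \<times> B. k \<otimes> l = m}"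

text \<open>If \<open>l\<close> were strictly below \<open>l'\<close>, strictness would put
  \<open>k \<otimes> l\<close> strictly below \<open>k' \<otimes> l'\<close>: along a fibre the
  second factor falls as the first one rises.\<close>

lemma mult_eq_antimono:
  assumes "k \<in> carrier M" "l \<in> carrier M" "k' \<in> carrier M" "l' \<in> carrier M"
    and "k \<otimes> l = k' \<otimes> l'" "(k, k') \<in> ord"
  shows "(l', l) \<in> ord"
  using ord_linear[of l' l] mult_strict_mono[of k k' l l'] assms by auto

text \<open>A pair in the fibre is determined by its first factor. Sets of first factors have least
  elements because \<open>A\<close> is well-ordered, and greatest ones because the second factors
  run in the opposite order and \<open>B\<close> is well-ordered.\<close>

lemma finite_fibre:
  assumes A: "wo A" and B: "wo B"
  shows "finite (fibre A B m)"
proof -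
  note carr = subsetD[OF wo_carrier[OF A]] subsetD[OF wo_carrier[OF B]]
  have inj: "inj_on fst (fibre A B m)"
  proof (rule inj_onI)
    fix p q assume "p \<in> fibre A B m" "q \<in> fibre A B m" "fst p = fst q"
    then show "p = q"
      using mult_eq_antimono[of "fst p" "snd p" "fst q" "snd q"]
        mult_eq_antimono[of "fst q" "snd q" "fst p" "snd p"] carr ord_refl ord_antisym
      by (auto simp: fibre_def)
  qed
  have "finite (fst ` fibre A B m)"
  proof (rule finite_of_min_max)
    have sub: "fst ` fibre A B m \<subseteq> A"
      by (auto simp: fibre_def)
    then show "fst ` fibre A B m \<subseteq> carrier M"
      using carr by auto
    fix Z assume Z: "Z \<subseteq> fst ` fibre A B m" "Z \<noteq> {}"
    then show "\<exists>x\<in>Z. \<forall>y\<in>Z. (x, y) \<in> ord"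
      using wo_min[OF A, of Z] sub by blast
    \<comment> \<open>The least second factor occurring over \<open>Z\<close> belongs to the
      greatest element of \<open>Z\<close>.\<close>
    have "{l. \<exists>k\<in>Z. (k, l) \<in> fibre A B m} \<subseteq> B"
      by (auto simp: fibre_def)
    moreover have "{l. \<exists>k\<in>Z. (k, l) \<in> fibre A B m} \<noteq> {}"
      using Z by fastforce
    ultimately obtain l where l: "\<exists>k\<in>Z. (k, l) \<in> fibre A B m"
        "\<And>k' l'. k' \<in> Z \<Longrightarrow> (k', l') \<in> fibre A B m \<Longrightarrow> (l, l') \<in> ord"
      using wo_min[OF B, of "{l. \<exists>k\<in>Z. (k, l) \<in> fibre A B m}"] by blast
    then obtain k where k: "k \<in> Z" "(k, l) \<in> fibre A B m"
      by blast
    have "(y, k) \<in> ord" if y: "y \<in> Z" for y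
    proof (rule ccontr)
      assume no: "(y, k) \<notin> ord"
      have "y \<in> fst ` fibre A B m"
        using y Z by blast
      then obtain l' where l': "(y, l') \<in> fibre A B m"
        by auto
      have "k \<prec>\<^sub>o y"
        using no ord_linear[of y k] carr k l' by (auto simp: fibre_def)
      moreover have "(l, l') \<in> ord"
        using l(2) y l' by blast
      ultimately have "k \<otimes> l \<prec>\<^sub>o y \<otimes> l'"
        using mult_strict_mono[of k y l l'] carr k l' by (auto simp: fibre_def)
      then show False
        using k l' by (auto simp: fibre_def)
    qed
    then show "\<exists>x\<in>Z. \<forall>y\<in>Z. (y, x) \<in> ord"
      using k by blast
  qed
  then show ?thesis
    using inj by (rule finite_imageD)
qed

end

section \<open>Idempotents and annihilators in reduced rings\<close>

context ring
begin

text \<open>The product on the left is \<open>x \<ominus> e \<otimes> x\<close>. Being fixed by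
  \<open>e\<close> thus becomes being annihilated by the complement of \<open>e\<close>, which links
  the order on idempotents with annihilators.\<close>

lemma one_minus_mult_eq_zero_iff:
  "e \<in> carrier R \<Longrightarrow> x \<in> carrier R \<Longrightarrow> (\<one> \<ominus> e) \<otimes> x = \<zero> \<longleftrightarrow> x = e \<otimes> x"
  using r_right_minus_eq[of x "e \<otimes> x"] by (simp add: minus_eq l_distr l_minus)

lemma mult_one_minus_eq_zero_iff:
  "e \<in> carrier R \<Longrightarrow> x \<in> carrier R \<Longrightarrow> x \<otimes> (\<one> \<ominus> e) = \<zero> \<longleftrightarrow> x = x \<otimes> e"
  using r_right_minus_eq[of x "x \<otimes> e"] by (simp add: minus_eq r_distr r_minus)

text \<open>The exponent can be lowered one step at a time: for positive \<open>n\<close>, the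
  square of \<open>a [^] n\<close> is a multiple of \<open>a [^] Suc n\<close>.\<close>

lemma reduced_ringI:
  assumes sq: "\<And>a. a \<in> carrier R \<Longrightarrow> a \<otimes> a = \<zero> \<Longrightarrow> a = \<zero>"
  shows "reduced_ring R"
proof unfold_locales
  fix a and n :: nat
  assume "a \<in> carrier R" "a [^] n = \<zero>"
  then show "a = \<zero>"
  proof (induction n)
    \<comment> \<open>Here the assumption reads \<open>\<one> = \<zero>\<close>, so the ring is
      trivial.\<close>
    case 0
    then show ?case
      using l_one[of a] by simp
  next
    case (Suc n)
    show ?case
    proof (cases n)
      case 0
      then show ?thesis
        using Suc.prems by simp
    next
      case (Suc k)
      have "a [^] n \<otimes> a [^] n = a [^] (Suc n + k)"
        using Suc.prems Suc nat_pow_mult[of a n n] by simp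
      also have "\<dots> = a [^] Suc n \<otimes> a [^] k"
        by (rule nat_pow_mult[OF Suc.prems(1), symmetric])
      finally have "a [^] n = \<zero>"
        using Suc.prems sq[of "a [^] n"] by simp
      then show ?thesis
        using Suc.IH Suc.prems by blast
    qed
  qed
qed

end

context reduced_ring
begin

lemma sq_eq_zeroD: "a \<in> carrier R \<Longrightarrow> a \<otimes> a = \<zero> \<Longrightarrow> a = \<zero>"
  using reduced[of a 2] by (simp add: numeral_2_eq_2)

text \<open>The square of \<open>b \<otimes> a\<close> contains the factor
  \<open>a \<otimes> b\<close>.\<close>

lemma mult_eq_zero_commute:
  assumes "a \<in> carrier R" "b \<in> carrier R" "a \<otimes> b = \<zero>"
  shows "b \<otimes> a = \<zero>"
proof (rule sq_eq_zeroD)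
  have "b \<otimes> a \<otimes> (b \<otimes> a) = b \<otimes> (a \<otimes> b) \<otimes> a"
    using assms(1,2) by (simp add: m_assoc)
  then show "b \<otimes> a \<otimes> (b \<otimes> a) = \<zero>"
    using assms by simp
qed (use assms in simp)

text \<open>The square of \<open>a \<otimes> r \<otimes> b\<close> contains
  \<open>b \<otimes> a\<close>, which vanishes together with \<open>a \<otimes> b\<close>.\<close>

lemma mult_eq_zero_insert:
  assumes "a \<in> carrier R" "b \<in> carrier R" "r \<in> carrier R" "a \<otimes> b = \<zero>"
  shows "a \<otimes> r \<otimes> b = \<zero>"
proof (rule sq_eq_zeroD)
  have "a \<otimes> r \<otimes> b \<otimes> (a \<otimes> r \<otimes> b) = a \<otimes> r \<otimes> (b \<otimes> a) \<otimes> r \<otimes> b"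
    using assms(1-3) by (simp add: m_assoc)
  then show "a \<otimes> r \<otimes> b \<otimes> (a \<otimes> r \<otimes> b) = \<zero>"
    using assms mult_eq_zero_commute[of a b] by simp
qed (use assms in simp)

text \<open>The products of \<open>e\<close> and \<open>\<one> \<ominus> e\<close> in either order
  are zero and stay zero when \<open>r\<close> is inserted, so \<open>e \<otimes> r\<close> and
  \<open>r \<otimes> e\<close> both equal \<open>e \<otimes> r \<otimes> e\<close>.\<close>

lemma idempotent_central:
  assumes "e \<in> carrier R" "e \<otimes> e = e" "r \<in> carrier R"
  shows "e \<otimes> r = r \<otimes> e"
proof -
  have "(\<one> \<ominus> e) \<otimes> r \<otimes> e = \<zero>" "e \<otimes> r \<otimes> (\<one> \<ominus> e) = \<zero>"
    using assms one_minus_mult_eq_zero_iff[of e e] mult_one_minus_eq_zero_iff[of e e]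
    by (auto intro!: mult_eq_zero_insert)
  then have "r \<otimes> e = e \<otimes> (r \<otimes> e)" "e \<otimes> r = e \<otimes> r \<otimes> e"
    using assms one_minus_mult_eq_zero_iff[of e "r \<otimes> e"]
      mult_one_minus_eq_zero_iff[of e "e \<otimes> r"] by (simp_all add: m_assoc)
  then show ?thesis
    using assms by (simp add: m_assoc)
qed

end

lemma (in ring) mem_idempotent_coset:
  assumes "e \<in> carrier R" "e \<otimes> e = e"
  shows "x \<in> e <# carrier R \<longleftrightarrow> x \<in> carrier R \<and> x = e \<otimes> x"
proof
  assume "x \<in> e <# carrier R"
  then obtain y where "y \<in> carrier R" "x = e \<otimes> y"
    by (auto simp: l_coset_def)
  then show "x \<in> carrier R \<and> x = e \<otimes> x"
    using assms by (simp flip: m_assoc)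
qed (auto simp: l_coset_def)

lemma carrier_idempotents: "e \<in> carrier (idempotents R) \<longleftrightarrow> e \<in> carrier R \<and> e \<otimes>\<^bsub>R\<^esub> e = e"
  by (simp add: idempotents_def)

text \<open>For idempotent \<open>e\<close>, the equation \<open>x = e \<otimes> x\<close> encodes
  membership in the right ideal generated by \<open>e\<close>. Allowing a set \<open>A\<close>
  covers both a single element and all coefficients of a series.\<close>

definition ann_generator :: "('a, 'b) ring_scheme \<Rightarrow> 'a set \<Rightarrow> 'a \<Rightarrow> bool"
  where "ann_generator R A e \<longleftrightarrow> e \<in> carrier R \<and> e \<otimes>\<^bsub>R\<^esub> e = e \<and>
    (\<forall>x\<in>carrier R. (\<forall>a\<in>A. a \<otimes>\<^bsub>R\<^esub> x = \<zero>\<^bsub>R\<^esub>) \<longleftrightarrow> x = e \<otimes>\<^bsub>R\<^esub> x)"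

lemma (in reduced_ring) weakly_Baer_iff:
  "weakly_Baer R \<longleftrightarrow> (\<forall>a\<in>carrier R. \<exists>e. ann_generator R {a} e)"
proof -
  have "ann R a = e <# carrier R \<longleftrightarrow> ann_generator R {a} e"
    if "a \<in> carrier R" "e \<in> carrier (idempotents R)" for a e
    using that mem_idempotent_coset[of e]
    by (auto simp: set_eq_iff ann_def ann_generator_def carrier_idempotents)
  moreover have "e \<in> carrier (idempotents R)" if "ann_generator R {a} e" for a e
    using that by (simp add: ann_generator_def carrier_idempotents)
  ultimately show ?thesis
    unfolding weakly_Baer_def using reduced_ring_axioms by blast
qed

section \<open>The ring of generalized power series\<close>

text \<open>The index set is the disjoint union of copies of the \<open>A i\<close>. Read
  additively, this regroups the nested convolution sums in the proof of associativity.\<close>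

lemma (in comm_monoid) finprod_Sigma:
  assumes "finite I" "\<And>i. i \<in> I \<Longrightarrow> finite (A i)"
    and g: "\<And>i x. i \<in> I \<Longrightarrow> x \<in> A i \<Longrightarrow> g i x \<in> carrier G"
  shows "finprod G (\<lambda>(i, x). g i x) (Sigma I A) = finprod G (\<lambda>i. finprod G (g i) (A i)) I"
proof -
  have "finprod G (\<lambda>(i, x). g i x) (Sigma I A) =
      finprod G (\<lambda>(i, x). g i x) (\<Union>i\<in>I. Pair i ` A i)"
    by (rule arg_cong[where f = "finprod G _"]) auto
  also have "\<dots> = finprod G (\<lambda>i. finprod G (\<lambda>(i, x). g i x) (Pair i ` A i)) I"
    by (rule finprod_UN_disjoint) (use assms in \<open>auto simp: pairwise_def disjnt_def\<close>)
  also have "\<dots> = finprod G (\<lambda>i. finprod G (g i) (A i)) I"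
  proof (rule finprod_cong')
    fix i assume "i \<in> I"
    then show "finprod G (\<lambda>(i, x). g i x) (Pair i ` A i) = finprod G (g i) (A i)"
      using g by (subst finprod_reindex) (auto simp: inj_on_def)
  qed (use g in \<open>auto intro!: finprod_closed\<close>)
  finally show ?thesis .
qed

locale power_series_ring = ring R + M: strict_ordered_monoid M ord
  for R (structure) and M (structure) and ord
begin

abbreviation S where "S \<equiv> gen_power_series R M ord"

abbreviation supp' where "supp' \<equiv> supp R M"

section \<open>Coefficients, supports and the convolution product\<close>

lemma series_iff:
  "f \<in> carrier S \<longleftrightarrow> f \<in> carrier M \<rightarrow>\<^sub>E carrier R \<and> M.wo (supp' f)"
  by (simp add: gen_power_series_def)

lemma coeff_closed [simp]: "f \<in> carrier S \<Longrightarrow> m \<in> carrier M \<Longrightarrow> f m \<in> carrier R"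
  by (auto simp: series_iff)

lemma wo_supp [simp]: "f \<in> carrier S \<Longrightarrow> M.wo (supp' f)"
  by (simp add: series_iff)

lemma series_eqI:
  assumes "f \<in> carrier S" "g \<in> carrier S" "\<And>m. m \<in> carrier M \<Longrightarrow> f m = g m"
  shows "f = g"
  using assms unfolding series_iff by (metis PiE_ext)

text \<open>The support is a subset of \<open>A\<close>, hence well-ordered itself, and need not be
  computed exactly.\<close>

lemma seriesI:
  assumes "M.wo A" "\<And>m. m \<in> carrier M \<Longrightarrow> f m \<in> carrier R"
    and "\<And>m. m \<in> carrier M \<Longrightarrow> m \<notin> A \<Longrightarrow> f m = \<zero>"
  shows "restrict f (carrier M) \<in> carrier S"
proof -
  have "supp' (restrict f (carrier M)) \<subseteq> A"
    using assms(3) by (auto simp: supp_def)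
  then show ?thesis
    using assms M.wo_subset by (auto simp: series_iff)
qed

lemma supp_subset_carrier: "supp' f \<subseteq> carrier M"
  by (auto simp: supp_def)

lemma not_in_supp: "m \<in> carrier M \<Longrightarrow> m \<notin> supp' f \<Longrightarrow> f m = \<zero>"
  by (simp add: supp_def)

lemma series_zero: "\<zero>\<^bsub>S\<^esub> = (\<lambda>m\<in>carrier M. \<zero>)"
  unfolding gen_power_series_def by simp

lemma add_coeff: "m \<in> carrier M \<Longrightarrow> (f \<oplus>\<^bsub>S\<^esub> g) m = f m \<oplus> g m"
  unfolding gen_power_series_def ring.simps by (simp only: restrict_apply if_True)

text \<open>Enlarging the supports to \<open>A\<close> and \<open>B\<close> adds only zero summands,
  and well-orderedness keeps the index set finite. Products of series with different supports can
  thus be compared over a common index set.\<close>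

lemma mult_coeff:
  assumes "f \<in> carrier S" "g \<in> carrier S" "m \<in> carrier M"
    and "M.wo A" "M.wo B" "supp' f \<subseteq> A" "supp' g \<subseteq> B"
  shows "(f \<otimes>\<^bsub>S\<^esub> g) m = finsum R (\<lambda>(k, l). f k \<otimes> g l) (M.fibre A B m)"
proof -
  note carr = subsetD[OF M.wo_carrier[OF assms(4)]] subsetD[OF M.wo_carrier[OF assms(5)]]
  have "(f \<otimes>\<^bsub>S\<^esub> g) m = finsum R (\<lambda>(k, l). f k \<otimes> g l) (M.fibre (supp' f) (supp' g) m)"
    using assms(3) unfolding gen_power_series_def M.fibre_def by simp
  also have "\<dots> = finsum R (\<lambda>(k, l). f k \<otimes> g l) (M.fibre A B m)"
  proof (rule add.finprod_mono_neutral_cong_left)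
    show "finite (M.fibre A B m)"
      by (rule M.finite_fibre[OF assms(4,5)])
    show "M.fibre (supp' f) (supp' g) m \<subseteq> M.fibre A B m"
      using assms(6,7) by (auto simp: M.fibre_def)
    show "(case p of (k, l) \<Rightarrow> f k \<otimes> g l) = \<zero>"
      if p': "p \<in> M.fibre A B m - M.fibre (supp' f) (supp' g) m" for p
    proof -
      obtain k l where p: "p = (k, l)" "k \<in> carrier M" "l \<in> carrier M"
        using p' carr by (auto simp: M.fibre_def)
      then have "f k = \<zero> \<or> g l = \<zero>"
        using p' not_in_supp by (auto simp: M.fibre_def)
      then show ?thesis
        using assms p by auto
    qed
    show "(\<lambda>(k, l). f k \<otimes> g l) \<in> M.fibre A B m \<rightarrow> carrier R"
      using assms(1,2) carr by (auto simp: M.fibre_def)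
  qed auto
  finally show ?thesis .
qed

lemma mult_coeff_closed:
  assumes "f \<in> carrier S" "g \<in> carrier S" "m \<in> carrier M"
  shows "(f \<otimes>\<^bsub>S\<^esub> g) m \<in> carrier R"
  unfolding mult_coeff[OF assms wo_supp[OF assms(1)] wo_supp[OF assms(2)] subset_refl subset_refl]
  using assms subsetD[OF supp_subset_carrier] by (intro finsum_closed) (auto simp: M.fibre_def)

lemma mult_eq_zero_outside:
  assumes "f \<in> carrier S" "g \<in> carrier S" "m \<in> carrier M"
    and "m \<notin> M.prod_set (supp' f) (supp' g)"
  shows "(f \<otimes>\<^bsub>S\<^esub> g) m = \<zero>"
proof -
  have "M.fibre (supp' f) (supp' g) m = {}"
    using assms(4) by (auto simp: M.fibre_def M.prod_set_def)
  then show ?thesis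
    using mult_coeff[OF assms(1-3) wo_supp wo_supp, of f g] assms by simp
qed

lemma supp_mult:
  assumes "f \<in> carrier S" "g \<in> carrier S"
  shows "supp' (f \<otimes>\<^bsub>S\<^esub> g) \<subseteq> M.prod_set (supp' f) (supp' g)"
  using mult_eq_zero_outside[OF assms] by (auto simp: supp_def)

lemma mult_closed:
  assumes "f \<in> carrier S" "g \<in> carrier S"
  shows "f \<otimes>\<^bsub>S\<^esub> g \<in> carrier S"
proof -
  have "restrict (f \<otimes>\<^bsub>S\<^esub> g) (carrier M) \<in> carrier S"
    using assms
    by (intro seriesI[of "M.prod_set (supp' f) (supp' g)"] M.wo_prod_set)
      (simp_all add: mult_coeff_closed mult_eq_zero_outside)
  then show ?thesis
    unfolding gen_power_series_def by simp
qed

lemma supp_add: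
  "supp' (f \<oplus>\<^bsub>S\<^esub> g) \<subseteq> supp' f \<union> supp' g"
  by (auto simp: supp_def add_coeff)

lemma add_closed:
  assumes "f \<in> carrier S" "g \<in> carrier S"
  shows "f \<oplus>\<^bsub>S\<^esub> g \<in> carrier S"
proof -
  have "restrict (f \<oplus>\<^bsub>S\<^esub> g) (carrier M) \<in> carrier S"
    using assms
    by (intro seriesI[of "supp' f \<union> supp' g"] M.wo_Un)
      (auto simp add: add_coeff not_in_supp)
  then show ?thesis
    unfolding gen_power_series_def by simp
qed

text \<open>Both coefficients at \<open>m\<close> are sums of the terms
  \<open>f j \<otimes> (g k \<otimes> h l)\<close> over the set \<open>T\<close> of triples with
  product \<open>m\<close>, grouped by the product of the first two or of the last two
  indices.\<close>

lemma mult_assoc: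
  assumes f: "f \<in> carrier S" and g: "g \<in> carrier S" and h: "h \<in> carrier S"
  shows "(f \<otimes>\<^bsub>S\<^esub> g) \<otimes>\<^bsub>S\<^esub> h = f \<otimes>\<^bsub>S\<^esub> (g \<otimes>\<^bsub>S\<^esub> h)"
proof (rule series_eqI)
  fix m assume m: "m \<in> carrier M"
  let ?A = "supp' f" and ?B = "supp' g" and ?C = "supp' h"
  \<comment> \<open>The outer sums run over full product sets: by cancellation the supports of the
    products of \<open>f\<close> and \<open>g\<close>, and of \<open>g\<close> and \<open>h\<close>,
    may be smaller, and then triples of \<open>T\<close> could be missed.\<close>
  let ?AB = "M.prod_set ?A ?B" and ?BC = "M.prod_set ?B ?C"
  note wo = wo_supp[OF f] wo_supp[OF g] wo_supp[OF h]
  note carr = subsetD[OF supp_subset_carrier]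
  define T where "T = {(j, k, l). j \<in> ?A \<and> k \<in> ?B \<and> l \<in> ?C \<and> j \<otimes>\<^bsub>M\<^esub> k \<otimes>\<^bsub>M\<^esub> l = m}"
  have T_carr: "j \<in> carrier M" "k \<in> carrier M" "l \<in> carrier M" if "(j, k, l) \<in> T" for j k l
    using that carr by (auto simp: T_def)
  let ?t = "\<lambda>(j, k, l). f j \<otimes> (g k \<otimes> h l)"
  let ?I = "Sigma (M.fibre ?AB ?C m) (\<lambda>(p, l). M.fibre ?A ?B p)"
  let ?J = "Sigma (M.fibre ?A ?BC m) (\<lambda>(j, p). M.fibre ?B ?C p)"
  let ?i = "\<lambda>(j, k, l). ((j \<otimes>\<^bsub>M\<^esub> k, l), (j, k))"
  let ?j = "\<lambda>(j, k, l). ((j, k \<otimes>\<^bsub>M\<^esub> l), (k, l))"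
  have "((f \<otimes>\<^bsub>S\<^esub> g) \<otimes>\<^bsub>S\<^esub> h) m =
      finsum R (\<lambda>(p, l). (f \<otimes>\<^bsub>S\<^esub> g) p \<otimes> h l) (M.fibre ?AB ?C m)"
    using f g h m wo by (intro mult_coeff mult_closed M.wo_prod_set supp_mult) auto
  also have "\<dots> = finsum R (\<lambda>x. finsum R (\<lambda>y. f (fst y) \<otimes> (g (snd y) \<otimes> h (snd x)))
      (case x of (p, l) \<Rightarrow> M.fibre ?A ?B p)) (M.fibre ?AB ?C m)"
  proof (rule finsum_cong')
    fix x assume "x \<in> M.fibre ?AB ?C m"
    then obtain p l where x: "x = (p, l)" "p \<in> carrier M" "l \<in> carrier M"
      using carr M.wo_carrier[OF M.wo_prod_set[OF wo(1,2)]] by (auto simp: M.fibre_def)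
    have "(f \<otimes>\<^bsub>S\<^esub> g) p \<otimes> h l = finsum R (\<lambda>(j, k). f j \<otimes> g k) (M.fibre ?A ?B p) \<otimes> h l"
      using f g x wo by (subst mult_coeff) auto
    also have "\<dots> = finsum R (\<lambda>y. (case y of (j, k) \<Rightarrow> f j \<otimes> g k) \<otimes> h l) (M.fibre ?A ?B p)"
      using f g h x wo carr M.finite_fibre by (intro finsum_ldistr) (auto simp: M.fibre_def)
    also have "\<dots> = finsum R (\<lambda>y. f (fst y) \<otimes> (g (snd y) \<otimes> h l)) (M.fibre ?A ?B p)"
      using f g h x carr by (intro finsum_cong') (auto simp: M.fibre_def m_assoc)
    finally show "(case x of (p, l) \<Rightarrow> (f \<otimes>\<^bsub>S\<^esub> g) p \<otimes> h l) =
        finsum R (\<lambda>y. f (fst y) \<otimes> (g (snd y) \<otimes> h (snd x)))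
          (case x of (p, l) \<Rightarrow> M.fibre ?A ?B p)"
      using x by simp
  qed (use f g h carr in \<open>auto intro!: finsum_closed simp: M.fibre_def split: prod.splits\<close>)
  also have "\<dots> = finsum R (\<lambda>(x, y). f (fst y) \<otimes> (g (snd y) \<otimes> h (snd x))) ?I"
  proof (rule add.finprod_Sigma[symmetric])
    show "f (fst y) \<otimes> (g (snd y) \<otimes> h (snd x)) \<in> carrier R"
      if "x \<in> M.fibre ?AB ?C m" "y \<in> (case x of (p, l) \<Rightarrow> M.fibre ?A ?B p)" for x y
      using that f g h carr by (auto simp: M.fibre_def split: prod.splits)
  qed (auto simp: M.finite_fibre M.wo_prod_set wo split: prod.split)
  \<comment> \<open>A nested index amounts to a triple in \<open>T\<close>, since its intermediate
    product is determined by the other entries.\<close>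
  also have "?I = ?i ` T"
  proof
    show "?I \<subseteq> ?i ` T"
      by (force simp: M.fibre_def T_def)
  qed (auto simp: M.fibre_def T_def intro: M.prod_setI)
  also have "finsum R (\<lambda>(x, y). f (fst y) \<otimes> (g (snd y) \<otimes> h (snd x))) (?i ` T) = finsum R ?t T"
    using f g h T_carr
    by (subst finsum_reindex) (auto simp: inj_on_def intro!: finsum_cong')
  also have "\<dots> = finsum R (\<lambda>(x, y). f (fst x) \<otimes> (g (fst y) \<otimes> h (snd y))) (?j ` T)"
    using f g h T_carr
    by (subst finsum_reindex) (auto simp: inj_on_def intro!: finsum_cong')
  also have "?j ` T = ?J"
  proof
    show "?J \<subseteq> ?j ` T"
    proof
      fix z assume "z \<in> ?J"
      then obtain j k l where z: "z = ((j, k \<otimes>\<^bsub>M\<^esub> l), (k, l))" "j \<in> ?A" "k \<in> ?B" "l \<in> ?C"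
          "j \<otimes>\<^bsub>M\<^esub> (k \<otimes>\<^bsub>M\<^esub> l) = m"
        by (auto simp: M.fibre_def)
      then have "(j, k, l) \<in> T"
        using carr by (auto simp: T_def M.m_assoc)
      then show "z \<in> ?j ` T"
        using z by force
    qed
  qed (use carr in \<open>auto simp: M.fibre_def T_def M.m_assoc intro: M.prod_setI\<close>)
  also have "finsum R (\<lambda>(x, y). f (fst x) \<otimes> (g (fst y) \<otimes> h (snd y))) ?J =
      finsum R (\<lambda>x. finsum R (\<lambda>y. f (fst x) \<otimes> (g (fst y) \<otimes> h (snd y)))
        (case x of (j, p) \<Rightarrow> M.fibre ?B ?C p)) (M.fibre ?A ?BC m)"
  proof (rule add.finprod_Sigma)
    show "f (fst x) \<otimes> (g (fst y) \<otimes> h (snd y)) \<in> carrier R"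
      if "x \<in> M.fibre ?A ?BC m" "y \<in> (case x of (j, p) \<Rightarrow> M.fibre ?B ?C p)" for x y
      using that f g h carr by (auto simp: M.fibre_def split: prod.splits)
  qed (auto simp: M.finite_fibre M.wo_prod_set wo split: prod.split)
  also have "\<dots> = finsum R (\<lambda>(j, p). f j \<otimes> (g \<otimes>\<^bsub>S\<^esub> h) p) (M.fibre ?A ?BC m)"
  proof (rule finsum_cong')
    fix x assume "x \<in> M.fibre ?A ?BC m"
    then obtain j p where x: "x = (j, p)" "j \<in> carrier M" "p \<in> carrier M"
      using carr M.wo_carrier[OF M.wo_prod_set[OF wo(2,3)]] by (auto simp: M.fibre_def)
    have "f j \<otimes> (g \<otimes>\<^bsub>S\<^esub> h) p = f j \<otimes> finsum R (\<lambda>(k, l). g k \<otimes> h l) (M.fibre ?B ?C p)"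
      using h g x wo by (subst mult_coeff) auto
    also have "\<dots> = finsum R (\<lambda>y. f j \<otimes> (case y of (k, l) \<Rightarrow> g k \<otimes> h l)) (M.fibre ?B ?C p)"
      using f g h x wo carr M.finite_fibre by (intro finsum_rdistr) (auto simp: M.fibre_def)
    also have "\<dots> = finsum R (\<lambda>y. f j \<otimes> (g (fst y) \<otimes> h (snd y))) (M.fibre ?B ?C p)"
      using f g h x carr by (intro finsum_cong') (auto simp: M.fibre_def)
    finally show "finsum R (\<lambda>y. f (fst x) \<otimes> (g (fst y) \<otimes> h (snd y)))
        (case x of (j, p) \<Rightarrow> M.fibre ?B ?C p) = (case x of (j, p) \<Rightarrow> f j \<otimes> (g \<otimes>\<^bsub>S\<^esub> h) p)"
      using x by simp
  qed (use f g h carr M.wo_carrier[OF M.wo_prod_set[OF wo(2,3)]] in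
      \<open>auto intro!: mult_coeff_closed simp: M.fibre_def\<close>)
  also have "\<dots> = (f \<otimes>\<^bsub>S\<^esub> (g \<otimes>\<^bsub>S\<^esub> h)) m"
    using f g h m wo by (intro mult_coeff[symmetric] mult_closed M.wo_prod_set supp_mult) auto
  finally show "((f \<otimes>\<^bsub>S\<^esub> g) \<otimes>\<^bsub>S\<^esub> h) m = (f \<otimes>\<^bsub>S\<^esub> (g \<otimes>\<^bsub>S\<^esub> h)) m" .
qed (use assms in \<open>auto intro!: mult_closed\<close>)

section \<open>Constant series and the remaining ring axioms\<close>

definition const :: "'a \<Rightarrow> 'c \<Rightarrow> 'a"
  where "const a = (\<lambda>m\<in>carrier M. if m = \<one>\<^bsub>M\<^esub> then a else \<zero>)"

lemma const_closed: "a \<in> carrier R \<Longrightarrow> const a \<in> carrier S"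
  unfolding const_def by (rule seriesI[OF M.wo_singleton, of "\<one>\<^bsub>M\<^esub>"]) auto

lemma const_coeff: "m \<in> carrier M \<Longrightarrow> const a m = (if m = \<one>\<^bsub>M\<^esub> then a else \<zero>)"
  by (simp add: const_def)

lemma supp_const: "supp' (const a) \<subseteq> {\<one>\<^bsub>M\<^esub>}"
  by (auto simp: supp_def const_def split: if_splits)

lemma series_one: "\<one>\<^bsub>S\<^esub> = const \<one>"
  unfolding gen_power_series_def const_def by simp

lemma const_mult_coeff:
  assumes "a \<in> carrier R" "f \<in> carrier S" "m \<in> carrier M"
  shows "(const a \<otimes>\<^bsub>S\<^esub> f) m = a \<otimes> f m"
proof -
  \<comment> \<open>Adding \<open>m\<close> to the support of \<open>f\<close> makes the index set
    the single pair of the unit of \<open>M\<close> and \<open>m\<close>, whether or not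
    \<open>f m\<close> vanishes.\<close>
  have "(const a \<otimes>\<^bsub>S\<^esub> f) m =
      finsum R (\<lambda>(k, l). const a k \<otimes> f l) (M.fibre {\<one>\<^bsub>M\<^esub>} (supp' f \<union> {m}) m)"
    using assms supp_const
    by (intro mult_coeff const_closed M.wo_Un M.wo_singleton wo_supp) auto
  also have "M.fibre {\<one>\<^bsub>M\<^esub>} (supp' f \<union> {m}) m = {(\<one>\<^bsub>M\<^esub>, m)}"
    using assms subsetD[OF supp_subset_carrier] by (auto simp: M.fibre_def)
  finally show ?thesis
    using assms by (simp add: const_coeff)
qed

lemma mult_const_coeff:
  assumes "a \<in> carrier R" "f \<in> carrier S" "m \<in> carrier M"
  shows "(f \<otimes>\<^bsub>S\<^esub> const a) m = f m \<otimes> a"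
proof -
  have "(f \<otimes>\<^bsub>S\<^esub> const a) m =
      finsum R (\<lambda>(k, l). f k \<otimes> const a l) (M.fibre (supp' f \<union> {m}) {\<one>\<^bsub>M\<^esub>} m)"
    using assms supp_const
    by (intro mult_coeff const_closed M.wo_Un M.wo_singleton wo_supp) auto
  also have "M.fibre (supp' f \<union> {m}) {\<one>\<^bsub>M\<^esub>} m = {(m, \<one>\<^bsub>M\<^esub>)}"
    using assms subsetD[OF supp_subset_carrier] by (auto simp: M.fibre_def)
  finally show ?thesis
    using assms by (simp add: const_coeff)
qed

text \<open>The supports of \<open>f\<close>, \<open>g\<close> and their sum all lie in the union of
  the first two, so the three convolution sums can be taken over one index set \<open>?F\<close> and
  compared termwise.\<close>

lemma add_mult_distrib:
  assumes f: "f \<in> carrier S" and g: "g \<in> carrier S" and h: "h \<in> carrier S"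
  shows "(f \<oplus>\<^bsub>S\<^esub> g) \<otimes>\<^bsub>S\<^esub> h = f \<otimes>\<^bsub>S\<^esub> h \<oplus>\<^bsub>S\<^esub> g \<otimes>\<^bsub>S\<^esub> h"
proof (rule series_eqI)
  fix m assume m: "m \<in> carrier M"
  let ?F = "M.fibre (supp' f \<union> supp' g) (supp' h) m"
  note carr = subsetD[OF supp_subset_carrier]
  have wo: "M.wo (supp' f \<union> supp' g)" "M.wo (supp' h)"
    using f g h by (auto intro: M.wo_Un)
  have F: "k \<in> carrier M" "l \<in> carrier M" if "(k, l) \<in> ?F" for k l
    using that carr by (auto simp: M.fibre_def)
  have "((f \<oplus>\<^bsub>S\<^esub> g) \<otimes>\<^bsub>S\<^esub> h) m = finsum R (\<lambda>(k, l). (f \<oplus>\<^bsub>S\<^esub> g) k \<otimes> h l) ?F"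
    using f g h m wo supp_add by (intro mult_coeff add_closed) auto
  also have "\<dots> = finsum R (\<lambda>p. (case p of (k, l) \<Rightarrow> f k \<otimes> h l) \<oplus> (case p of (k, l) \<Rightarrow> g k \<otimes> h l)) ?F"
    using f g h F by (intro finsum_cong') (auto simp: add_coeff l_distr)
  also have "\<dots> = finsum R (\<lambda>(k, l). f k \<otimes> h l) ?F \<oplus> finsum R (\<lambda>(k, l). g k \<otimes> h l) ?F"
    using f g h F by (intro finsum_addf) auto
  also have "\<dots> = (f \<otimes>\<^bsub>S\<^esub> h) m \<oplus> (g \<otimes>\<^bsub>S\<^esub> h) m"
    using f g h m wo by (intro arg_cong2[where f = "(\<oplus>)"] mult_coeff[symmetric]) auto
  finally show "((f \<oplus>\<^bsub>S\<^esub> g) \<otimes>\<^bsub>S\<^esub> h) m = (f \<otimes>\<^bsub>S\<^esub> h \<oplus>\<^bsub>S\<^esub> g \<otimes>\<^bsub>S\<^esub> h) m"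
    using m by (simp only: add_coeff)
qed (use assms in \<open>auto intro!: mult_closed add_closed\<close>)

lemma mult_add_distrib:
  assumes f: "f \<in> carrier S" and g: "g \<in> carrier S" and h: "h \<in> carrier S"
  shows "h \<otimes>\<^bsub>S\<^esub> (f \<oplus>\<^bsub>S\<^esub> g) = h \<otimes>\<^bsub>S\<^esub> f \<oplus>\<^bsub>S\<^esub> h \<otimes>\<^bsub>S\<^esub> g"
proof (rule series_eqI)
  fix m assume m: "m \<in> carrier M"
  let ?F = "M.fibre (supp' h) (supp' f \<union> supp' g) m"
  note carr = subsetD[OF supp_subset_carrier]
  have wo: "M.wo (supp' f \<union> supp' g)" "M.wo (supp' h)"
    using f g h by (auto intro: M.wo_Un)
  have F: "k \<in> carrier M" "l \<in> carrier M" if "(k, l) \<in> ?F" for k l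
    using that carr by (auto simp: M.fibre_def)
  have "(h \<otimes>\<^bsub>S\<^esub> (f \<oplus>\<^bsub>S\<^esub> g)) m = finsum R (\<lambda>(k, l). h k \<otimes> (f \<oplus>\<^bsub>S\<^esub> g) l) ?F"
    using f g h m wo supp_add by (intro mult_coeff add_closed) auto
  also have "\<dots> = finsum R (\<lambda>p. (case p of (k, l) \<Rightarrow> h k \<otimes> f l) \<oplus> (case p of (k, l) \<Rightarrow> h k \<otimes> g l)) ?F"
    using f g h F by (intro finsum_cong') (auto simp: add_coeff r_distr)
  also have "\<dots> = finsum R (\<lambda>(k, l). h k \<otimes> f l) ?F \<oplus> finsum R (\<lambda>(k, l). h k \<otimes> g l) ?F"
    using f g h F by (intro finsum_addf) auto
  also have "\<dots> = (h \<otimes>\<^bsub>S\<^esub> f) m \<oplus> (h \<otimes>\<^bsub>S\<^esub> g) m"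
    using f g h m wo by (intro arg_cong2[where f = "(\<oplus>)"] mult_coeff[symmetric]) auto
  finally show "(h \<otimes>\<^bsub>S\<^esub> (f \<oplus>\<^bsub>S\<^esub> g)) m = (h \<otimes>\<^bsub>S\<^esub> f \<oplus>\<^bsub>S\<^esub> h \<otimes>\<^bsub>S\<^esub> g) m"
    using m by (simp only: add_coeff)
qed (use assms in \<open>auto intro!: mult_closed add_closed\<close>)

lemma zero_closed_series: "\<zero>\<^bsub>S\<^esub> \<in> carrier S"
  unfolding series_zero by (rule seriesI[OF M.wo_singleton, of "\<one>\<^bsub>M\<^esub>"]) auto

lemma zero_coeff: "m \<in> carrier M \<Longrightarrow> \<zero>\<^bsub>S\<^esub> m = \<zero>"
  by (simp add: series_zero)

lemma ring_series: "ring S"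
proof (rule ringI)
  show "abelian_group S"
  proof (rule abelian_groupI)
    fix f assume f: "f \<in> carrier S"
    let ?g = "\<lambda>m\<in>carrier M. \<ominus> f m"
    have g: "?g \<in> carrier S"
      using f by (intro seriesI[of "supp' f"]) (auto simp: not_in_supp)
    have "?g \<oplus>\<^bsub>S\<^esub> f = \<zero>\<^bsub>S\<^esub>"
      using f g
      by (intro series_eqI add_closed zero_closed_series) (simp_all add: add_coeff zero_coeff l_neg)
    then show "\<exists>g\<in>carrier S. g \<oplus>\<^bsub>S\<^esub> f = \<zero>\<^bsub>S\<^esub>"
      using g by blast
  next
    fix f g h assume "f \<in> carrier S" "g \<in> carrier S" "h \<in> carrier S"
    then show "f \<oplus>\<^bsub>S\<^esub> g \<oplus>\<^bsub>S\<^esub> h = f \<oplus>\<^bsub>S\<^esub> (g \<oplus>\<^bsub>S\<^esub> h)"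
      by (intro series_eqI add_closed) (simp_all add: add_coeff a_assoc)
  next
    fix f g assume "f \<in> carrier S" "g \<in> carrier S"
    then show "f \<oplus>\<^bsub>S\<^esub> g = g \<oplus>\<^bsub>S\<^esub> f"
      by (intro series_eqI add_closed) (simp_all add: add_coeff a_comm)
  next
    fix f assume "f \<in> carrier S"
    then show "\<zero>\<^bsub>S\<^esub> \<oplus>\<^bsub>S\<^esub> f = f"
      by (intro series_eqI add_closed zero_closed_series) (simp_all add: add_coeff zero_coeff)
  qed (auto intro: add_closed zero_closed_series)
  show "monoid S"
  proof (rule monoidI)
    fix f assume "f \<in> carrier S"
    then show "\<one>\<^bsub>S\<^esub> \<otimes>\<^bsub>S\<^esub> f = f" "f \<otimes>\<^bsub>S\<^esub> \<one>\<^bsub>S\<^esub> = f"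
      unfolding series_one
      by (intro series_eqI mult_closed const_closed one_closed;
          simp add: const_mult_coeff mult_const_coeff)+
  qed (auto intro: mult_closed mult_assoc const_closed simp: series_one)
qed (auto intro: add_mult_distrib mult_add_distrib)

text \<open>Negation in \<open>S\<close> is available only as the additive inverse, so its
  coefficients are identified by uniqueness of inverses in \<open>R\<close>.\<close>

lemma minus_coeff:
  assumes "f \<in> carrier S" "g \<in> carrier S" "m \<in> carrier M"
  shows "(f \<ominus>\<^bsub>S\<^esub> g) m = f m \<ominus> g m"
proof -
  interpret S: ring S
    by (rule ring_series)
  have "(\<ominus>\<^bsub>S\<^esub> g \<oplus>\<^bsub>S\<^esub> g) m = \<zero>"
    using assms by (simp add: S.l_neg zero_coeff)
  then have "(\<ominus>\<^bsub>S\<^esub> g) m \<oplus> g m = \<zero>"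
    using assms(3) by (simp only: add_coeff)
  then have "(\<ominus>\<^bsub>S\<^esub> g) m = \<ominus> g m"
    using assms minus_equality by simp
  then show ?thesis
    using assms by (simp add: S.minus_eq minus_eq add_coeff)
qed

end

section \<open>Power series over a reduced ring\<close>

locale reduced_power_series_ring = power_series_ring + reduced_ring R
begin

text \<open>At a minimal \<open>m = k \<otimes> l\<close> with \<open>f k \<otimes> g l \<noteq> \<zero>\<close> and, for this \<open>m\<close>, minimal \<open>k\<close>,
  multiplying the coefficient of \<open>f \<otimes> g\<close> at \<open>m\<close> by \<open>f k\<close> from the right kills all other summands.\<close>

lemma mult_eq_zeroD:
  assumes f: "f \<in> carrier S" and g: "g \<in> carrier S" and fg: "f \<otimes>\<^bsub>S\<^esub> g = \<zero>\<^bsub>S\<^esub>"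
    and "k0 \<in> carrier M" "l0 \<in> carrier M"
  shows "f k0 \<otimes> g l0 = \<zero>"
proof (rule ccontr)
  assume nz: "f k0 \<otimes> g l0 \<noteq> \<zero>"
  note carr = subsetD[OF supp_subset_carrier]
  define P where "P = {(k, l). k \<in> carrier M \<and> l \<in> carrier M \<and> f k \<otimes> g l \<noteq> \<zero>}"
  have P_supp: "k \<in> supp' f" "l \<in> supp' g" if "(k, l) \<in> P" for k l
    using that f g by (auto simp: P_def supp_def)
  have "(\<lambda>(k, l). k \<otimes>\<^bsub>M\<^esub> l) ` P \<subseteq> M.prod_set (supp' f) (supp' g)"
    using P_supp by (auto intro!: M.prod_setI)
  moreover have "(\<lambda>(k, l). k \<otimes>\<^bsub>M\<^esub> l) ` P \<noteq> {}"
    using nz assms(4,5) by (auto simp: P_def)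
  ultimately obtain m where m: "m \<in> (\<lambda>(k, l). k \<otimes>\<^bsub>M\<^esub> l) ` P"
      and m_min: "\<forall>y \<in> (\<lambda>(k, l). k \<otimes>\<^bsub>M\<^esub> l) ` P. (m, y) \<in> ord"
    using M.wo_min[OF M.wo_prod_set[OF wo_supp[OF f] wo_supp[OF g]]] by meson
  define K where "K = {k. \<exists>l. (k, l) \<in> P \<and> k \<otimes>\<^bsub>M\<^esub> l = m}"
  have "K \<subseteq> supp' f" "K \<noteq> {}"
    using m P_supp by (auto simp: K_def)
  then obtain k where "k \<in> K" and k_min: "\<forall>y\<in>K. (k, y) \<in> ord"
    using M.wo_min[OF wo_supp[OF f]] by meson
  then obtain l where kl: "(k, l) \<in> P" "k \<otimes>\<^bsub>M\<^esub> l = m"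
    by (auto simp: K_def)
  have kl_carr: "k \<in> carrier M" "l \<in> carrier M" "m \<in> carrier M"
    using kl by (auto simp: P_def)
  let ?F = "M.fibre (supp' f) (supp' g) m"
  have F: "k' \<in> carrier M" "l' \<in> carrier M" "k' \<otimes>\<^bsub>M\<^esub> l' = m" if "(k', l') \<in> ?F" for k' l'
    using that carr by (auto simp: M.fibre_def)
  \<comment> \<open>If \<open>k' = k\<close>, the pair is \<open>(k, l)\<close> itself. If
    \<open>k'\<close> lies below \<open>k\<close>, then \<open>f k' \<otimes> g l'\<close> is zero
    by the choice of \<open>k\<close>. If \<open>k'\<close> lies above \<open>k\<close>, then
    \<open>k\<close> times \<open>l'\<close> lies below \<open>m\<close>, so
    \<open>f k \<otimes> g l'\<close> is zero by the choice of \<open>m\<close>, and hence so is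
    \<open>g l' \<otimes> f k\<close>.\<close>
  have kill: "f k' \<otimes> g l' \<otimes> f k = \<zero>" if F': "(k', l') \<in> ?F" "(k', l') \<noteq> (k, l)" for k' l'
  proof -
    consider "k' = k" | "(k, k') \<notin> ord" | "(k, k') \<in> ord" "k \<noteq> k'"
      by blast
    then show ?thesis
    proof cases
      case 1
      then have "l' = l"
        using M.mult_eq_antimono[of k l k l'] M.mult_eq_antimono[of k l' k l] F[OF F'(1)] kl kl_carr
          M.ord_refl M.ord_antisym by auto
      then show ?thesis
        using F' 1 by simp
    next
      case 2
      then have "(k', l') \<notin> P"
        using k_min F[OF F'(1)] by (auto simp: K_def)
      then have "f k' \<otimes> g l' = \<zero>"
        using F[OF F'(1)] by (auto simp: P_def)
      then show ?thesis
        using f kl_carr by simp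
    next
      case 3
      then have lt: "(k \<otimes>\<^bsub>M\<^esub> l', m) \<in> ord" "k \<otimes>\<^bsub>M\<^esub> l' \<noteq> m"
        using M.strict_right[of k k' l'] F[OF F'(1)] kl_carr by auto
      have "(k, l') \<notin> P"
      proof
        assume "(k, l') \<in> P"
        then have "(m, k \<otimes>\<^bsub>M\<^esub> l') \<in> ord"
          using m_min by force
        then show False
          using lt M.ord_antisym by blast
      qed
      then have "f k \<otimes> g l' = \<zero>"
        using F[OF F'(1)] kl_carr by (auto simp: P_def)
      then have "g l' \<otimes> f k = \<zero>"
        using f g F[OF F'(1)] kl_carr mult_eq_zero_commute by simp
      then show ?thesis
        using f g F[OF F'(1)] kl_carr by (simp add: m_assoc)
    qed
  qed
  have "finsum R (\<lambda>(k, l). f k \<otimes> g l) ?F = \<zero>"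
    using mult_coeff[OF f g kl_carr(3), of "supp' f" "supp' g"] f g fg kl_carr
    by (simp add: zero_coeff)
  then have "\<zero> = finsum R (\<lambda>(k, l). f k \<otimes> g l) ?F \<otimes> f k"
    using f kl_carr by simp
  also have "\<dots> = finsum R (\<lambda>p. (case p of (k, l) \<Rightarrow> f k \<otimes> g l) \<otimes> f k) ?F"
    using f g kl_carr F M.finite_fibre by (intro finsum_ldistr) auto
  also have "\<dots> = finsum R (\<lambda>p. (case p of (k, l) \<Rightarrow> f k \<otimes> g l) \<otimes> f k) {(k, l)}"
  proof (rule add.finprod_mono_neutral_cong_right)
    show "{(k, l)} \<subseteq> ?F"
      using kl P_supp by (auto simp: M.fibre_def)
    show "(case p of (k, l) \<Rightarrow> f k \<otimes> g l) \<otimes> f k = \<zero>" if "p \<in> ?F - {(k, l)}" for p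
      using kill[of "fst p" "snd p"] that by (cases p) auto
  qed (use f g kl_carr F M.finite_fibre in auto)
  also have "\<dots> = f k \<otimes> g l \<otimes> f k"
    using f g kl_carr by simp
  finally have "f k \<otimes> g l \<otimes> f k = \<zero>" ..
  \<comment> \<open>Multiplying by \<open>g l\<close> produces the square of
    \<open>f k \<otimes> g l\<close>, so this product vanishes, against the choice of
    \<open>(k, l)\<close>.\<close>
  then have "f k \<otimes> g l \<otimes> f k \<otimes> g l = \<zero>"
    using g kl_carr by simp
  then have "f k \<otimes> g l \<otimes> (f k \<otimes> g l) = \<zero>"
    using f g kl_carr m_assoc[of "f k \<otimes> g l" "f k" "g l"] by simp
  then show False
    using sq_eq_zeroD[of "f k \<otimes> g l"] kl f g by (auto simp: P_def)
qed

section \<open>Reducedness, idempotents and annihilators of the series ring\<close>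

lemma reduced_series: "reduced_ring S"
proof (rule ring.reduced_ringI[OF ring_series])
  fix f assume f: "f \<in> carrier S" "f \<otimes>\<^bsub>S\<^esub> f = \<zero>\<^bsub>S\<^esub>"
  have "f m = \<zero>" if "m \<in> carrier M" for m
    using mult_eq_zeroD[OF f(1) f that that] sq_eq_zeroD coeff_closed[OF f(1) that] by blast
  then show "f = \<zero>\<^bsub>S\<^esub>"
    using f by (intro series_eqI zero_closed_series) (simp_all add: zero_coeff)
qed

lemma mult_eq_zero_iff:
  assumes f: "f \<in> carrier S" and g: "g \<in> carrier S"
  shows "f \<otimes>\<^bsub>S\<^esub> g = \<zero>\<^bsub>S\<^esub> \<longleftrightarrow> (\<forall>k\<in>carrier M. \<forall>l\<in>carrier M. f k \<otimes> g l = \<zero>)"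
proof
  assume 0: "\<forall>k\<in>carrier M. \<forall>l\<in>carrier M. f k \<otimes> g l = \<zero>"
  show "f \<otimes>\<^bsub>S\<^esub> g = \<zero>\<^bsub>S\<^esub>"
  proof (intro series_eqI mult_closed zero_closed_series f g)
    fix m assume m: "m \<in> carrier M"
    have "(f \<otimes>\<^bsub>S\<^esub> g) m = finsum R (\<lambda>(k, l). f k \<otimes> g l) (M.fibre (supp' f) (supp' g) m)"
      using f g m by (intro mult_coeff) auto
    also have "\<dots> = \<zero>"
      using 0 subsetD[OF supp_subset_carrier] by (intro add.finprod_one_eqI) (auto simp: M.fibre_def)
    finally show "(f \<otimes>\<^bsub>S\<^esub> g) m = \<zero>\<^bsub>S\<^esub> m"
      using m by (simp add: zero_coeff)
  qed
qed (use mult_eq_zeroD[OF f g] in blast)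

text \<open>The product of \<open>e\<close> and its complement is zero, which gives
  \<open>e k \<otimes> (const \<one> k \<ominus> e k) = \<zero>\<close>. Away from the unit of
  \<open>M\<close> this says that \<open>e k\<close> has square zero, so \<open>e k\<close> is zero;
  at the unit it is idempotence.\<close>

lemma idempotent_series:
  assumes e: "e \<in> carrier S" and idem: "e \<otimes>\<^bsub>S\<^esub> e = e"
  shows "e = const (e \<one>\<^bsub>M\<^esub>)" "e \<one>\<^bsub>M\<^esub> \<otimes> e \<one>\<^bsub>M\<^esub> = e \<one>\<^bsub>M\<^esub>"
proof -
  interpret S: ring S
    by (rule ring_series)
  have "e \<otimes>\<^bsub>S\<^esub> (\<one>\<^bsub>S\<^esub> \<ominus>\<^bsub>S\<^esub> e) = \<zero>\<^bsub>S\<^esub>"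
    using S.mult_one_minus_eq_zero_iff e idem by simp
  then have *: "e k \<otimes> (\<one>\<^bsub>S\<^esub> \<ominus>\<^bsub>S\<^esub> e) k = \<zero>" if "k \<in> carrier M" for k
    using mult_eq_zeroD e that by simp
  have 0: "e k \<otimes> (const \<one> k \<ominus> e k) = \<zero>" if "k \<in> carrier M" for k
    using *[OF that] that e minus_coeff[of "\<one>\<^bsub>S\<^esub>" e k] S.one_closed by (simp add: series_one)
  have nz: "e k = \<zero>" if "k \<in> carrier M" "k \<noteq> \<one>\<^bsub>M\<^esub>" for k
    using 0[of k] that e sq_eq_zeroD[of "e k"] by (simp add: const_coeff minus_eq r_minus)
  have e1: "e \<one>\<^bsub>M\<^esub> \<in> carrier R"
    using e by simp
  then show "e = const (e \<one>\<^bsub>M\<^esub>)"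
    using nz by (intro series_eqI e const_closed) (auto simp: const_coeff)
  show "e \<one>\<^bsub>M\<^esub> \<otimes> e \<one>\<^bsub>M\<^esub> = e \<one>\<^bsub>M\<^esub>"
    using 0[of "\<one>\<^bsub>M\<^esub>"] e1 mult_one_minus_eq_zero_iff[of "e \<one>\<^bsub>M\<^esub>" "e \<one>\<^bsub>M\<^esub>"]
    by (simp add: const_coeff)
qed

text \<open>The product of \<open>f\<close> and \<open>g\<close> is zero exactly when each
  coefficient of \<open>g\<close> lies in the common annihilator of the coefficients of
  \<open>f\<close>. As idempotents of \<open>S\<close> are constant, a generator on one side gives
  one on the other.\<close>

lemma weakly_Baer_series_iff:
  "weakly_Baer S \<longleftrightarrow> (\<forall>f\<in>carrier S. \<exists>e. ann_generator R (f ` carrier M) e)"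
proof -
  interpret S: reduced_ring S
    by (rule reduced_series)
  have const_iff: "ann_generator S {f} (const e) \<longleftrightarrow> ann_generator R (f ` carrier M) e"
    if f: "f \<in> carrier S" and e: "e \<in> carrier R" "e \<otimes> e = e" for f e
  proof -
    have idem: "const e \<otimes>\<^bsub>S\<^esub> const e = const e"
      using e by (intro series_eqI mult_closed const_closed)
        (simp_all add: const_mult_coeff const_closed const_coeff)
    have fix_iff: "g = const e \<otimes>\<^bsub>S\<^esub> g \<longleftrightarrow> (\<forall>l\<in>carrier M. g l = e \<otimes> g l)" if "g \<in> carrier S" for g
    proof
      assume "g = const e \<otimes>\<^bsub>S\<^esub> g"
      then show "\<forall>l\<in>carrier M. g l = e \<otimes> g l"
        using const_mult_coeff[OF e(1) that] by metis
    qed (use that e const_mult_coeff in \<open>auto intro!: series_eqI mult_closed const_closed\<close>)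
    show ?thesis
    proof
      assume gen: "ann_generator S {f} (const e)"
      \<comment> \<open>Testing on the constant series \<open>const x\<close> recovers the condition
        on \<open>x\<close> in \<open>R\<close>.\<close>
      have "(\<forall>k\<in>carrier M. f k \<otimes> x = \<zero>) \<longleftrightarrow> x = e \<otimes> x" if x: "x \<in> carrier R" for x
      proof -
        have "(\<forall>k\<in>carrier M. f k \<otimes> x = \<zero>) \<longleftrightarrow> f \<otimes>\<^bsub>S\<^esub> const x = \<zero>\<^bsub>S\<^esub>"
          using f x by (auto simp: mult_eq_zero_iff const_closed const_coeff)
        also have "\<dots> \<longleftrightarrow> const x = const e \<otimes>\<^bsub>S\<^esub> const x"
          using gen x by (simp add: ann_generator_def const_closed)
        also have "\<dots> \<longleftrightarrow> x = e \<otimes> x"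
          using e x by (auto simp: fix_iff const_closed const_coeff)
        finally show ?thesis .
      qed
      then show "ann_generator R (f ` carrier M) e"
        using e by (simp add: ann_generator_def)
    next
      assume gen: "ann_generator R (f ` carrier M) e"
      have "f \<otimes>\<^bsub>S\<^esub> g = \<zero>\<^bsub>S\<^esub> \<longleftrightarrow> g = const e \<otimes>\<^bsub>S\<^esub> g" if g: "g \<in> carrier S" for g
      proof -
        \<comment> \<open>Both conditions on \<open>g\<close> split into conditions on its single
          coefficients, to which \<open>gen\<close> applies.\<close>
        have "(\<forall>k\<in>carrier M. f k \<otimes> g l = \<zero>) \<longleftrightarrow> g l = e \<otimes> g l" if "l \<in> carrier M" for l
          using gen coeff_closed[OF g that] by (simp add: ann_generator_def)
        then show ?thesis
          unfolding mult_eq_zero_iff[OF f g] fix_iff[OF g] by blast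
      qed
      then show "ann_generator S {f} (const e)"
        using e idem by (simp add: ann_generator_def const_closed)
    qed
  qed
  have "(\<exists>e. ann_generator S {f} e) \<longleftrightarrow> (\<exists>e. ann_generator R (f ` carrier M) e)"
    if f: "f \<in> carrier S" for f
  proof
    assume "\<exists>e. ann_generator S {f} e"
    then obtain e where e: "ann_generator S {f} e" "e \<in> carrier S" "e \<otimes>\<^bsub>S\<^esub> e = e"
      by (auto simp: ann_generator_def)
    then have "ann_generator S {f} (const (e \<one>\<^bsub>M\<^esub>))"
      using idempotent_series(1) by metis
    then show "\<exists>e. ann_generator R (f ` carrier M) e"
      using const_iff[OF f, of "e \<one>\<^bsub>M\<^esub>"] e idempotent_series(2) by auto
  next
    assume "\<exists>e. ann_generator R (f ` carrier M) e"
    then show "\<exists>e. ann_generator S {f} e"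
      using const_iff[OF f] unfolding ann_generator_def[of R] by blast
  qed
  then show ?thesis
    unfolding S.weakly_Baer_iff by blast
qed

section \<open>Transfer of the weakly Baer property and of completeness between \<open>R\<close> and
  \<open>S\<close>\<close>

lemma weakly_Baer_of_series:
  assumes "weakly_Baer S"
  shows "weakly_Baer R"
  unfolding weakly_Baer_iff
proof
  fix a assume a: "a \<in> carrier R"
  then obtain e where e: "ann_generator R (const a ` carrier M) e"
    using assms const_closed unfolding weakly_Baer_series_iff by blast
  \<comment> \<open>The zero coefficients of \<open>const a\<close> impose no condition, and the
    unit of \<open>M\<close> contributes \<open>a\<close>.\<close>
  have "(\<forall>k\<in>carrier M. const a k \<otimes> x = \<zero>) \<longleftrightarrow> a \<otimes> x = \<zero>" if "x \<in> carrier R" for x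
    using that by (auto simp: const_coeff)
  then have "ann_generator R {a} e"
    using e by (simp add: ann_generator_def)
  then show "\<exists>e. ann_generator R {a} e"
    by blast
qed

text \<open>Given an injection \<open>w\<close> of \<open>E\<close> into a well-ordered set, the annihilator of the series
  with coefficient \<open>\<one> \<ominus> e\<close> at \<open>w e\<close> is generated by the infimum of \<open>E\<close>.\<close>

lemma kappa_complete_of_series:
  assumes wB: "weakly_Baer S" and W: "M.wo W" "|W| =o \<kappa>"
  shows "kappa_complete \<kappa> (idempotents R)"
  unfolding kappa_complete_def
proof (intro allI impI, elim conjE)
  fix E assume E: "E \<subseteq> carrier (idempotents R)" "|E| \<le>o \<kappa>"
  then have "|E| \<le>o |W|"
    using W(2) ordLeq_ordIso_trans ordIso_symmetric by blast
  then obtain w where w: "inj_on w E" "w ` E \<subseteq> W"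
    using card_of_ordLeq by metis
  define f where "f = (\<lambda>m\<in>carrier M. if m \<in> w ` E then \<one> \<ominus> the_inv_into E w m else \<zero>)"
  have E': "e \<in> carrier R" "e \<otimes> e = e" if "e \<in> E" for e
    using subsetD[OF E(1) that] by (simp_all add: carrier_idempotents)
  have inv: "the_inv_into E w (w e) = e" if "e \<in> E" for e
    using that w(1) by (rule the_inv_into_f_f[rotated])
  have wM: "w e \<in> carrier M" if "e \<in> E" for e
    using that w(2) M.wo_carrier[OF W(1)] by blast
  have "f \<in> carrier S"
    unfolding f_def using w(2) E'(1) inv by (intro seriesI[OF W(1)]) auto
  then obtain i where i: "ann_generator R (f ` carrier M) i"
    using wB unfolding weakly_Baer_series_iff by blast
  have "(\<forall>k\<in>carrier M. f k \<otimes> x = \<zero>) \<longleftrightarrow> (\<forall>e\<in>E. x = e \<otimes> x)" if x: "x \<in> carrier R" for x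
  proof -
    have "(\<forall>k\<in>carrier M. f k \<otimes> x = \<zero>) \<longleftrightarrow> (\<forall>e\<in>E. f (w e) \<otimes> x = \<zero>)"
      using x wM by (auto simp: f_def)
    also have "\<dots> \<longleftrightarrow> (\<forall>e\<in>E. x = e \<otimes> x)"
      using x E' wM inv one_minus_mult_eq_zero_iff by (intro ball_cong) (simp_all add: f_def)
    finally show ?thesis .
  qed
  then have i: "i \<in> carrier R" "i \<otimes> i = i"
      "\<And>x. x \<in> carrier R \<Longrightarrow> (\<forall>e\<in>E. x = e \<otimes> x) \<longleftrightarrow> x = i \<otimes> x"
    using i by (simp_all add: ann_generator_def)
  \<comment> \<open>Putting \<open>x = i\<close> yields \<open>i = e \<otimes> i\<close> for each
    \<open>e\<close> in \<open>E\<close>, and centrality turns this into the order relation.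
    Conversely, a lower bound \<open>j\<close> is fixed by every \<open>e\<close>, hence by
    \<open>i\<close>.\<close>
  have "i \<in> Lower (idempotents R) E"
    using i(1,2) i(3)[of i] E' idempotent_central[of _ i] by (auto simp: Lower_def idempotents_def)
  moreover have "j = j \<otimes> i" if "j \<in> Lower (idempotents R) E" for j
  proof -
    have j: "j \<in> carrier R" "j \<otimes> j = j" "\<forall>e\<in>E. j = j \<otimes> e"
      using that E' by (auto simp: Lower_def idempotents_def)
    then have "\<forall>e\<in>E. j = e \<otimes> j"
      using E' idempotent_central[of _ j] by metis
    then show ?thesis
      using i j idempotent_central[of i j] by metis
  qed
  ultimately have "greatest (idempotents R) i (Lower (idempotents R) E)"
    by (auto simp: greatest_def Lower_def idempotents_def)
  then show "\<exists>i. greatest (idempotents R) i (Lower (idempotents R) E)"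
    by blast
qed

text \<open>The bound on well-ordered subsets makes the family of idempotents attached to a support
  small enough to have an infimum \<open>i\<close>. That \<open>i\<close> fixes each
  \<open>x\<close> annihilated by all coefficients follows by comparing \<open>i\<close> with the
  least idempotent fixing \<open>x\<close>.\<close>

lemma weakly_Baer_seriesI:
  assumes wB: "weakly_Baer R" and complete: "kappa_complete \<kappa> (idempotents R)"
    and max: "\<And>W. M.wo W \<Longrightarrow> |W| \<le>o \<kappa>"
  shows "weakly_Baer S"
  unfolding weakly_Baer_series_iff
proof
  fix f assume f: "f \<in> carrier S"
  obtain e where e: "ann_generator R {a} (e a)" if "a \<in> carrier R" for a
    using wB unfolding weakly_Baer_iff by metis
  have e_carr: "e a \<in> carrier R" "e a \<otimes> e a = e a" if "a \<in> carrier R" for a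
    using e[OF that] by (auto simp: ann_generator_def)
  have e_iff: "a \<otimes> x = \<zero> \<longleftrightarrow> x = e a \<otimes> x" if "a \<in> carrier R" "x \<in> carrier R" for a x
    using e[OF that(1)] that by (auto simp: ann_generator_def)
  \<comment> \<open>Only the support is used: coefficients off it are zero and impose no condition,
    while \<open>M\<close> may have more than \<open>\<kappa>\<close> elements.\<close>
  let ?E = "(\<lambda>k. e (f k)) ` supp' f"
  have fk: "f k \<in> carrier R" if "k \<in> supp' f" for k
    using that f subsetD[OF supp_subset_carrier] by auto
  have E: "?E \<subseteq> carrier (idempotents R)"
    using e_carr fk by (auto simp: carrier_idempotents)
  moreover have "|?E| \<le>o \<kappa>"
    using card_of_image max[OF wo_supp[OF f]] ordLeq_transitive by blast
  ultimately obtain i where i: "greatest (idempotents R) i (Lower (idempotents R) ?E)"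
    using complete unfolding kappa_complete_def by blast
  then have i_carr: "i \<in> carrier R" "i \<otimes> i = i"
    by (auto simp: greatest_def Lower_def idempotents_def)
  have i_le: "i = i \<otimes> e (f k)" if "k \<in> supp' f" for k
    using i E that by (auto simp: greatest_def Lower_def idempotents_def)
  have i_max: "d = d \<otimes> i"
    if "d \<in> carrier R" "d \<otimes> d = d" "\<And>k. k \<in> supp' f \<Longrightarrow> d = d \<otimes> e (f k)" for d
  proof -
    have "d \<in> Lower (idempotents R) ?E"
      using that by (auto simp: Lower_def idempotents_def)
    then show ?thesis
      using i by (simp add: greatest_def idempotents_def)
  qed
  have "(\<forall>k\<in>carrier M. f k \<otimes> x = \<zero>) \<longleftrightarrow> x = i \<otimes> x" if x: "x \<in> carrier R" for x
  proof
    assume 0: "\<forall>k\<in>carrier M. f k \<otimes> x = \<zero>"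
    \<comment> \<open>As \<open>h\<close> generates the annihilator of \<open>x\<close>, its
      complement \<open>d\<close> is the least idempotent fixing \<open>x\<close>. Unlike
      \<open>x\<close>, it can be compared with the idempotents \<open>e (f k)\<close>.\<close>
    define h where "h = e x"
    define d where "d = \<one> \<ominus> h"
    have h: "h \<in> carrier R" "h \<otimes> h = h"
      using e_carr[OF x] by (simp_all add: h_def)
    have h_iff: "x \<otimes> y = \<zero> \<longleftrightarrow> y = h \<otimes> y" if "y \<in> carrier R" for y
      using e_iff[OF x that] by (simp add: h_def)
    have d: "d \<in> carrier R"
      using h by (simp add: d_def)
    have "d \<otimes> h = \<zero>"
      using h one_minus_mult_eq_zero_iff[of h h] by (simp add: d_def)
    then have "d \<otimes> (\<one> \<ominus> h) = d"
      using h d by (simp add: minus_eq r_distr r_minus)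
    then have "d \<otimes> d = d"
      by (simp flip: d_def)
    moreover have "d = d \<otimes> e (f k)" if k: "k \<in> supp' f" for k
    proof -
      let ?ek = "e (f k)"
      note ek = e_carr[OF fk[OF k]]
      have "x = ?ek \<otimes> x"
        using 0 k subsetD[OF supp_subset_carrier k] e_iff[OF fk[OF k] x] by blast
      also have "\<dots> = x \<otimes> ?ek"
        using idempotent_central ek x by blast
      finally have "x \<otimes> (\<one> \<ominus> ?ek) = \<zero>"
        using mult_one_minus_eq_zero_iff[of ?ek x] ek x by blast
      \<comment> \<open>The complement of \<open>?ek\<close> annihilates \<open>x\<close>, so it is
        a multiple of \<open>h\<close> and is killed by \<open>d\<close>; that is, \<open>d\<close>
        lies below \<open>?ek\<close>.\<close>
      then have "d \<otimes> (\<one> \<ominus> ?ek) = \<zero>"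
        using h_iff[of "\<one> \<ominus> ?ek"] one_minus_mult_eq_zero_iff[of h "\<one> \<ominus> ?ek"] h ek
        by (simp add: d_def)
      then show ?thesis
        using mult_one_minus_eq_zero_iff[of ?ek d] ek d by blast
    qed
    ultimately have "d = d \<otimes> i"
      using i_max d by blast
    also have "\<dots> = i \<otimes> d"
      using idempotent_central[of i d] i_carr d by simp
    finally have di: "d = i \<otimes> d" .
    have "h \<otimes> x = \<zero>"
      using h_iff[of h] h x mult_eq_zero_commute[of x h] by simp
    then have dx: "d \<otimes> x = x"
      using h x by (simp add: d_def minus_eq l_distr l_minus)
    \<comment> \<open>Since \<open>d\<close> fixes \<open>x\<close> and lies below \<open>i\<close>,
      also \<open>i\<close> fixes \<open>x\<close>.\<close>
    have "i \<otimes> x = i \<otimes> d \<otimes> x"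
      using i_carr d x dx by (simp add: m_assoc)
    also have "i \<otimes> d = d"
      using di ..
    finally show "x = i \<otimes> x"
      unfolding dx ..
  next
    assume ix: "x = i \<otimes> x"
    show "\<forall>k\<in>carrier M. f k \<otimes> x = \<zero>"
    proof
      fix k assume k: "k \<in> carrier M"
      show "f k \<otimes> x = \<zero>"
      proof (cases "k \<in> supp' f")
        case True
        let ?ek = "e (f k)"
        note ek = e_carr[OF fk[OF True]]
        \<comment> \<open>As \<open>i\<close> lies below \<open>?ek\<close>, whatever
          \<open>i\<close> fixes is fixed by \<open>?ek\<close> and so is annihilated by
          \<open>f k\<close>.\<close>
        have "?ek \<otimes> i = i"
          using i_le[OF True, symmetric] idempotent_central[of ?ek i] ek i_carr by simp
        then have "?ek \<otimes> (i \<otimes> x) = i \<otimes> x"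
          using ek i_carr x by (simp flip: m_assoc)
        then have "?ek \<otimes> x = x"
          unfolding ix[symmetric] .
        then show ?thesis
          by (simp add: e_iff[OF fk[OF True] x])
      qed (use k x in \<open>simp add: not_in_supp\<close>)
    qed
  qed
  then have "ann_generator R (f ` carrier M) i"
    using i_carr by (simp add: ann_generator_def)
  then show "\<exists>i. ann_generator R (f ` carrier M) i"
    by blast
qed

end

theorem theorem6p3:
  fixes R :: "('a, 'b) ring_scheme" and M :: "('m, 'n) monoid_scheme"
    and ord :: "'m rel" and \<kappa> :: "'k rel"
  assumes "reduced_ring R"
    and "strict_ordered_monoid M ord"
    and "largest_wo_cardinality (carrier M) ord \<kappa>"
  shows "weakly_Baer (gen_power_series R M ord) \<longleftrightarrow>
    weakly_Baer R \<and> kappa_complete \<kappa> (idempotents R)"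
proof -
  interpret R: reduced_ring R
    by (rule assms(1))
  interpret M: strict_ordered_monoid M ord
    by (rule assms(2))
  interpret reduced_power_series_ring R M ord
    by unfold_locales
  \<comment> \<open>A well-ordered subset of cardinality \<open>\<kappa>\<close> yields
    completeness; the bound on all well-ordered subsets yields the converse.\<close>
  show ?thesis
    using assms(3) weakly_Baer_of_series kappa_complete_of_series weakly_Baer_seriesI
    unfolding largest_wo_cardinality_def by blast
qed

end
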